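(* Let $n,m\ge 1$ be integers, $t>0$, $\Delta t=t/m$, let $G:\mathbb{R}\times\mathbb{R}^n\to\mathbb{R}^n$ be differentiable, and let $x_0\in\mathbb{R}^n$. Let $E(t,m,\cdot)$ be the implicit Euler map with $m$ uniform steps, with iterates $x_1,\dots,x_m$ started at $x_0$ and step residuals $F_i$ (as defined in the context), and assume that $E$ is differentially invertible at $(t,m,x_0)$. Suppose the $n\times n$ matrices $\frac{\partial F_i}{\partial x}(x_i,x_{i-1},\Delta t)$, $i=1,\dots,m$, have been stored at the end of the respective implicit Euler steps (requiring $\mathcal{O}(m\cdot n^2)$ memory). Then, for every given $v\in\mathbb{R}^n$, the vector $E'(t,m,x_0)^{-1}\cdot v$ can be computed from these stored matrices and $v$ with $\mathcal{O}(m\cdot n^2)$ arithmetic operations (additions and multiplications of real numbers), the implied constant being independent of $m$, $n$, $G$, $t$, $x_0$ and $v$.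
   Context: For $i=1,\dots,m$ the residual of the $i$-th implicit Euler step is $$F_i(x,z,\Delta t)=x-z-\Delta t\cdot G(i\,\Delta t,x),\qquad x,z\in\mathbb{R}^n,$$ and $\frac{\partial F_i}{\partial x}(x,z,\Delta t)=I_n-\Delta t\cdot\frac{\partial G}{\partial x}(i\,\Delta t,x)\in\mathbb{R}^{n\times n}$ denotes its Jacobian with respect to its first argument. The implicit Euler iterates $x_1,\dots,x_m$ for the system $\frac{dx}{dt}=G(t,x(t))$ with initial state $x_0$ satisfy $F_i(x_i,x_{i-1},\Delta t)=0$ for $i=1,\dots,m$. Standing assumption: for each $i$ this equation defines $x_i$ implicitly as a differentiable function of $x_{i-1}$, i.e. there are an open neighborhood $U_{i-1}$ of $x_{i-1}$ and a map $\varphi_i:U_{i-1}\to\mathbb{R}^n$, differentiable at $x_{i-1}$, with $\varphi_i(x_{i-1})=x_i$ and $F_i(\varphi_i(z),z,\Delta t)=0$ for all $z\in U_{i-1}$. For $x$ in a neighborhood of $x_0$, the implicit Euler map is $E(t,m,x)=\varphi_m(\cdots\varphi_1(x)\cdots)$, so that $E(t,m,x_0)=x_m$. $E'(t,m,x_0)=\frac{dE}{dx}(t,m,x_0)\in\mathbb{R}^{n\times n}$ is the Jacobian with respect to the initial state. $E$ is called differentially invertible at $(t,m,x_0)$ if it is differentiable with respect to the initial state there and $E'(t,m,x_0)$ is invertible. The cost counted is that of the differential inversion in addition to running the underlying implicit Euler scheme. *)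

theory Defs
  imports
    "HOL-Analysis.L2_Norm"
    "Jordan_Normal_Form.Gauss_Jordan_Elimination"
begin

text \<open>
  The bound on the operation count is uniform in the dimension \<open>n\<close>, so \<open>n\<close> is a bound variable of
  the statement. Hence \<open>\<real>\<^sup>n\<close> is the carrier \<^term>\<open>carrier_vec n\<close> of dimension-indexed vectors rather
  than a finite Cartesian power indexed by a type, and the Euclidean topology and the Frechet
  derivative are spelled out on these carriers.
\<close>

definition euclid_norm :: "real vec \<Rightarrow> real" where
  "euclid_norm v = L2_set (\<lambda>i. v $ i) {..<dim_vec v}"

definition open_in_space :: "nat \<Rightarrow> real vec set \<Rightarrow> bool" where
  "open_in_space n U \<longleftrightarrow> U \<subseteq> carrier_vec n \<and>
     (\<forall>x\<in>U. \<exists>\<epsilon>>0. \<forall>y\<in>carrier_vec n. euclid_norm (y - x) < \<epsilon> \<longrightarrow> y \<in> U)"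

text \<open>
  Frechet derivative at \<open>x\<close>, represented by its matrix. The dimensions of domain and codomain are
  read off from \<open>x\<close> and \<open>f x\<close>; values of \<open>f\<close> away from \<open>x\<close> are irrelevant.
\<close>

definition has_jacobian :: "(real vec \<Rightarrow> real vec) \<Rightarrow> real mat \<Rightarrow> real vec \<Rightarrow> bool" where
  "has_jacobian f J x \<longleftrightarrow>
     J \<in> carrier_mat (dim_vec (f x)) (dim_vec x) \<and>
     (\<forall>\<epsilon>>0. \<exists>\<delta>>0. \<forall>y\<in>carrier_vec (dim_vec x). euclid_norm (y - x) < \<delta> \<longrightarrow>
        euclid_norm (f y - f x - J *\<^sub>v (y - x)) \<le> \<epsilon> * euclid_norm (y - x))"

definition differentiable_vec :: "(real vec \<Rightarrow> real vec) \<Rightarrow> real vec \<Rightarrow> bool" where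
  "differentiable_vec f x \<longleftrightarrow> (\<exists>J. has_jacobian f J x)"

definition jacobian :: "(real vec \<Rightarrow> real vec) \<Rightarrow> real vec \<Rightarrow> real mat" where
  "jacobian f x = (THE J. has_jacobian f J x)"

definition differentially_invertible :: "(real vec \<Rightarrow> real vec) \<Rightarrow> real vec \<Rightarrow> bool" where
  "differentially_invertible f x \<longleftrightarrow> differentiable_vec f x \<and> invertible_mat (jacobian f x)"

text \<open>
  Joint differentiability of \<open>G : \<real> \<times> \<real>\<^sup>n \<rightarrow> \<real>\<^sup>n\<close> everywhere; the pair \<open>(s, y)\<close> is identified with the
  vector \<open>(s, y\<^sub>0, \<dots>, y\<^sub>n\<^sub>-\<^sub>1)\<close> of dimension \<open>n + 1\<close>.
\<close>

definition differentiable_field :: "nat \<Rightarrow> (real \<Rightarrow> real vec \<Rightarrow> real vec) \<Rightarrow> bool" where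
  "differentiable_field n G \<longleftrightarrow>
     (\<forall>s. \<forall>y\<in>carrier_vec n. G s y \<in> carrier_vec n) \<and>
     (\<forall>p\<in>carrier_vec (Suc n). differentiable_vec (\<lambda>q. G (q $ 0) (vec n (\<lambda>i. q $ Suc i))) p)"

definition euler_residual ::
  "(real \<Rightarrow> real vec \<Rightarrow> real vec) \<Rightarrow> nat \<Rightarrow> real vec \<Rightarrow> real vec \<Rightarrow> real \<Rightarrow> real vec" where
  "euler_residual G i x z dt = x - z - dt \<cdot>\<^sub>v G (real i * dt) x"

text \<open>
  \<open>x\<close> are the iterates, and \<open>\<phi> i\<close>, defined on the neighbourhood \<open>U (i - 1)\<close> of \<open>x (i - 1)\<close>, is the
  solution map of the \<open>i\<close>-th step. Being a HOL function, \<open>\<phi> i\<close> is total, but nothing is assumed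
  about it outside \<open>U (i - 1)\<close>.
\<close>

definition implicit_euler ::
  "nat \<Rightarrow> nat \<Rightarrow> real \<Rightarrow> (real \<Rightarrow> real vec \<Rightarrow> real vec) \<Rightarrow> (nat \<Rightarrow> real vec) \<Rightarrow>
   (nat \<Rightarrow> real vec set) \<Rightarrow> (nat \<Rightarrow> real vec \<Rightarrow> real vec) \<Rightarrow> bool" where
  "implicit_euler n m dt G x U \<phi> \<longleftrightarrow>
     (\<forall>i\<le>m. x i \<in> carrier_vec n) \<and>
     (\<forall>i\<in>{1..m}.
        euler_residual G i (x i) (x (i - 1)) dt = 0\<^sub>v n \<and>
        open_in_space n (U (i - 1)) \<and> x (i - 1) \<in> U (i - 1) \<and>
        \<phi> i ` U (i - 1) \<subseteq> carrier_vec n \<and>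
        differentiable_vec (\<phi> i) (x (i - 1)) \<and>
        \<phi> i (x (i - 1)) = x i \<and>
        (\<forall>z\<in>U (i - 1). euler_residual G i (\<phi> i z) z dt = 0\<^sub>v n))"

primrec euler_map :: "(nat \<Rightarrow> real vec \<Rightarrow> real vec) \<Rightarrow> nat \<Rightarrow> real vec \<Rightarrow> real vec" where
  "euler_map \<phi> 0 x = x"
| "euler_map \<phi> (Suc i) x = \<phi> (Suc i) (euler_map \<phi> i x)"

definition stored_matrices ::
  "(real \<Rightarrow> real vec \<Rightarrow> real vec) \<Rightarrow> nat \<Rightarrow> real \<Rightarrow> (nat \<Rightarrow> real vec) \<Rightarrow> real mat list" where
  "stored_matrices G m dt x =
     map (\<lambda>i. jacobian (\<lambda>y. euler_residual G i y (x (i - 1)) dt) (x i)) [1..<Suc m]"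

definition matrix_data :: "real mat list \<Rightarrow> real list" where
  "matrix_data As = concat (map (\<lambda>A. concat (mat_to_list A)) As)"

text \<open>
  Arithmetic straight-line programs. The memory initially holds the input numbers, and each
  instruction appends the sum or product of two earlier memory cells. The cost is the number of
  instructions. Programs contain no constants, so all information about the problem instance
  has to come from the input.
\<close>

datatype instr = Add nat nat | Mul nat nat

fun exec_instr :: "instr \<Rightarrow> real list \<Rightarrow> real list" where
  "exec_instr (Add i j) mem = mem @ [mem ! i + mem ! j]"
| "exec_instr (Mul i j) mem = mem @ [mem ! i * mem ! j]"

fun valid_instr :: "nat \<Rightarrow> instr \<Rightarrow> bool" where
  "valid_instr k (Add i j) \<longleftrightarrow> i < k \<and> j < k"
| "valid_instr k (Mul i j) \<longleftrightarrow> i < k \<and> j < k"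

text \<open>\<open>k\<close> is the number of inputs, and \<open>outs\<close> lists the memory cells that are returned.\<close>

definition valid_program :: "nat \<Rightarrow> instr list \<Rightarrow> nat list \<Rightarrow> bool" where
  "valid_program k P outs \<longleftrightarrow>
     (\<forall>l<length P. valid_instr (k + l) (P ! l)) \<and> (\<forall>a\<in>set outs. a < k + length P)"

definition run_program :: "instr list \<Rightarrow> nat list \<Rightarrow> real list \<Rightarrow> real list" where
  "run_program P outs inputs = map ((!) (fold exec_instr P inputs)) outs"

end

theory Submission
  imports Defs "Jordan_Normal_Form.Determinant"
begin

text \<open>
  Differentiating \<open>F\<^sub>i(\<phi>\<^sub>i(z), z, \<Delta>t) = 0\<close> in \<open>z\<close> gives \<open>A\<^sub>i \<cdot> \<phi>\<^sub>i'(x\<^sub>i\<^sub>-\<^sub>1) = I\<close> for the stored matrix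
  \<open>A\<^sub>i\<close>, because \<open>F\<^sub>i\<close> depends on its second argument through \<open>-z\<close> only. By the chain rule
  \<open>E' = A\<^sub>m\<^sup>-\<^sup>1 \<cdots> A\<^sub>1\<^sup>-\<^sup>1\<close>, so \<open>E'\<^sup>-\<^sup>1 v = A\<^sub>1 (A\<^sub>2 (\<cdots> (A\<^sub>m v)))\<close>. Evaluated from right to left, this is \<open>m\<close>
  matrix-vector products, and no linear system has to be solved.
\<close>

section \<open>Jacobians on carriers\<close>

lemma euclid_norm_ge_0 [simp]: "euclid_norm v \<ge> 0"
  by (simp add: euclid_norm_def L2_set_nonneg)

lemma euclid_norm_triangle:
  assumes "a \<in> carrier_vec n" "b \<in> carrier_vec n"
  shows "euclid_norm (a + b) \<le> euclid_norm a + euclid_norm b"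
proof -
  have "euclid_norm (a + b) = L2_set (\<lambda>i. a $ i + b $ i) {..<n}"
    using assms by (auto simp: euclid_norm_def intro!: L2_set_cong)
  also have "\<dots> \<le> euclid_norm a + euclid_norm b"
    using assms L2_set_triangle_ineq[of "\<lambda>i. a $ i" "\<lambda>i. b $ i" "{..<n}"]
    by (auto simp: euclid_norm_def)
  finally show ?thesis .
qed

lemma abs_component_le_euclid_norm:
  assumes "i < dim_vec v"
  shows "\<bar>v $ i\<bar> \<le> euclid_norm v"
proof -
  have "\<bar>v $ i\<bar> \<le> L2_set (\<lambda>i. \<bar>v $ i\<bar>) {..<dim_vec v}"
    using assms by (intro member_le_L2_set) auto
  also have "\<dots> = euclid_norm v" by (simp add: euclid_norm_def L2_set_def)
  finally show ?thesis .
qed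

lemma euclid_norm_zero [simp]: "euclid_norm (0\<^sub>v n) = 0"
  by (simp add: euclid_norm_def L2_set_def)

lemma euclid_norm_smult: "euclid_norm (c \<cdot>\<^sub>v v) = \<bar>c\<bar> * euclid_norm v"
proof -
  have "euclid_norm (c \<cdot>\<^sub>v v) = L2_set (\<lambda>i. c * v $ i) {..<dim_vec v}"
    by (auto simp: euclid_norm_def intro!: L2_set_cong)
  also have "\<dots> = \<bar>c\<bar> * euclid_norm v"
    by (simp add: euclid_norm_def L2_set_def power_mult_distrib real_sqrt_mult flip: sum_distrib_left)
  finally show ?thesis .
qed

lemma euclid_norm_unit_vec: "j < n \<Longrightarrow> euclid_norm (unit_vec n j) = 1"
  by (simp add: euclid_norm_def L2_set_def unit_vec_def if_distrib[of "\<lambda>x. x\<^sup>2"] cong: if_cong)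

lemma mult_mat_vec_bounded:
  fixes A :: "real mat"
  obtains K where "K \<ge> 0" "\<And>v. v \<in> carrier_vec (dim_col A) \<Longrightarrow> euclid_norm (A *\<^sub>v v) \<le> K * euclid_norm v"
proof
  define K where "K = (\<Sum>i<dim_row A. \<Sum>j<dim_col A. \<bar>A $$ (i, j)\<bar>)"
  show "K \<ge> 0" by (auto simp: K_def intro!: sum_nonneg)
  fix v :: "real vec" assume v: "v \<in> carrier_vec (dim_col A)"
  have "euclid_norm (A *\<^sub>v v) \<le> (\<Sum>i<dim_row A. \<bar>(A *\<^sub>v v) $ i\<bar>)"
    by (simp add: euclid_norm_def L2_set_le_sum_abs del: index_mult_mat_vec)
  also have "\<dots> \<le> (\<Sum>i<dim_row A. \<Sum>j<dim_col A. \<bar>A $$ (i, j)\<bar> * euclid_norm v)"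
  proof (intro sum_mono)
    fix i assume i: "i \<in> {..<dim_row A}"
    have "\<bar>(A *\<^sub>v v) $ i\<bar> = \<bar>\<Sum>j<dim_col A. A $$ (i, j) * v $ j\<bar>"
      using i v by (simp add: scalar_prod_def atLeast0LessThan)
    also have "\<dots> \<le> (\<Sum>j<dim_col A. \<bar>A $$ (i, j) * v $ j\<bar>)" by (rule sum_abs)
    also have "\<dots> \<le> (\<Sum>j<dim_col A. \<bar>A $$ (i, j)\<bar> * euclid_norm v)"
      using v by (intro sum_mono) (auto simp: abs_mult intro!: mult_left_mono abs_component_le_euclid_norm)
    finally show "\<bar>(A *\<^sub>v v) $ i\<bar> \<le> (\<Sum>j<dim_col A. \<bar>A $$ (i, j)\<bar> * euclid_norm v)" .
  qed
  also have "\<dots> = K * euclid_norm v" by (simp add: K_def sum_distrib_right)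
  finally show "euclid_norm (A *\<^sub>v v) \<le> K * euclid_norm v" .
qed

lemma has_jacobian_carrier:
  "has_jacobian f J x \<Longrightarrow> J \<in> carrier_mat (dim_vec (f x)) (dim_vec x)"
  by (simp add: has_jacobian_def)

lemma has_jacobianE:
  assumes "has_jacobian f J x" "\<epsilon> > 0"
  obtains \<delta> where "\<delta> > 0"
    "\<And>y. y \<in> carrier_vec (dim_vec x) \<Longrightarrow> euclid_norm (y - x) < \<delta> \<Longrightarrow>
       euclid_norm (f y - f x - J *\<^sub>v (y - x)) \<le> \<epsilon> * euclid_norm (y - x)"
  using assms unfolding has_jacobian_def by blast

lemma has_jacobian_unique:
  assumes J: "has_jacobian f J x" and J': "has_jacobian f J' x"
  shows "J = J'"
proof (rule eq_matI)
  note c = has_jacobian_carrier[OF J] has_jacobian_carrier[OF J']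
  show "dim_row J = dim_row J'" "dim_col J = dim_col J'" using c by auto
  fix i j assume "i < dim_row J'" "j < dim_col J'"
  then have i: "i < dim_vec (f x)" and j: "j < dim_vec x" using c by auto
  have "\<bar>J $$ (i, j) - J' $$ (i, j)\<bar> \<le> \<epsilon>" if \<epsilon>: "\<epsilon> > 0" for \<epsilon>
  proof -
    have \<epsilon>2: "\<epsilon> / 2 > 0" using \<epsilon> by simp
    obtain d where d: "d > 0"
      "\<And>y. y \<in> carrier_vec (dim_vec x) \<Longrightarrow> euclid_norm (y - x) < d \<Longrightarrow>
         euclid_norm (f y - f x - J *\<^sub>v (y - x)) \<le> \<epsilon> / 2 * euclid_norm (y - x)"
      using has_jacobianE[OF J \<epsilon>2] by blast
    obtain d' where d': "d' > 0"
      "\<And>y. y \<in> carrier_vec (dim_vec x) \<Longrightarrow> euclid_norm (y - x) < d' \<Longrightarrow>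
         euclid_norm (f y - f x - J' *\<^sub>v (y - x)) \<le> \<epsilon> / 2 * euclid_norm (y - x)"
      using has_jacobianE[OF J' \<epsilon>2] by blast
    define h where "h = min d d' / 2"
    have h: "h > 0" "h < d" "h < d'" using d(1) d'(1) by (auto simp: h_def)
    define y where "y = x + h \<cdot>\<^sub>v unit_vec (dim_vec x) j"
    have y: "y \<in> carrier_vec (dim_vec x)" by (intro carrier_vecI) (simp add: y_def)
    have yx: "y - x = h \<cdot>\<^sub>v unit_vec (dim_vec x) j"
      by (intro eq_vecI) (simp_all add: y_def)
    have nyx: "euclid_norm (y - x) = h"
      using h j by (simp add: yx euclid_norm_smult euclid_norm_unit_vec)
    have entry: "(M *\<^sub>v (y - x)) $ i = h * M $$ (i, j)"
      if "M \<in> carrier_mat (dim_vec (f x)) (dim_vec x)" for M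
      using that i j by (simp add: yx)
    have "\<bar>(f y - f x - J *\<^sub>v (y - x)) $ i\<bar> \<le> \<epsilon> / 2 * h"
      using abs_component_le_euclid_norm[of i "f y - f x - J *\<^sub>v (y - x)"] d(2)[OF y] c(1) i h nyx
      by (simp del: index_mult_mat_vec)
    then have 1: "\<bar>(f y $ i - f x $ i) - h * J $$ (i, j)\<bar> \<le> \<epsilon> / 2 * h"
      using c(1) i entry[OF c(1)] by (simp del: index_mult_mat_vec)
    have "\<bar>(f y - f x - J' *\<^sub>v (y - x)) $ i\<bar> \<le> \<epsilon> / 2 * h"
      using abs_component_le_euclid_norm[of i "f y - f x - J' *\<^sub>v (y - x)"] d'(2)[OF y] c(2) i h nyx
      by (simp del: index_mult_mat_vec)
    then have 2: "\<bar>(f y $ i - f x $ i) - h * J' $$ (i, j)\<bar> \<le> \<epsilon> / 2 * h"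
      using c(2) i entry[OF c(2)] by (simp del: index_mult_mat_vec)
    have "h * \<bar>J $$ (i, j) - J' $$ (i, j)\<bar> = \<bar>h * J $$ (i, j) - h * J' $$ (i, j)\<bar>"
      using h by (simp add: abs_mult flip: right_diff_distrib)
    also have "\<dots> \<le> \<epsilon> / 2 * h + \<epsilon> / 2 * h" using 1 2 by linarith
    also have "\<dots> = h * \<epsilon>" by simp
    finally show ?thesis using h by simp
  qed
  then show "J $$ (i, j) = J' $$ (i, j)"
    by (metis abs_le_zero_iff eq_iff_diff_eq_0 field_le_epsilon add_0)
qed

lemma jacobian_eqI: "has_jacobian f J x \<Longrightarrow> jacobian f x = J"
  unfolding jacobian_def by (blast intro: has_jacobian_unique)

lemma has_jacobian_transform:
  assumes J: "has_jacobian f J x" and d: "d > 0"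
    and eq: "\<And>y. y \<in> carrier_vec (dim_vec x) \<Longrightarrow> euclid_norm (y - x) < d \<Longrightarrow> f y = g y"
  shows "has_jacobian g J x"
proof -
  have "euclid_norm (x - x) < d"
    unfolding minus_cancel_vec[OF carrier_vec_dim_vec] using d by simp
  then have x: "f x = g x" by (rule eq[OF carrier_vec_dim_vec])
  show ?thesis unfolding has_jacobian_def
  proof (intro conjI allI impI)
    show "J \<in> carrier_mat (dim_vec (g x)) (dim_vec x)" using has_jacobian_carrier[OF J] x by simp
    fix \<epsilon> :: real assume \<epsilon>: "\<epsilon> > 0"
    obtain e where e: "e > 0"
      "\<And>y. y \<in> carrier_vec (dim_vec x) \<Longrightarrow> euclid_norm (y - x) < e \<Longrightarrow>
         euclid_norm (f y - f x - J *\<^sub>v (y - x)) \<le> \<epsilon> * euclid_norm (y - x)"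
      using has_jacobianE[OF J \<epsilon>] by blast
    have "euclid_norm (g y - g x - J *\<^sub>v (y - x)) \<le> \<epsilon> * euclid_norm (y - x)"
      if y: "y \<in> carrier_vec (dim_vec x)" "euclid_norm (y - x) < min d e" for y
    proof -
      have "g y = f y" using eq[of y] y by simp
      then show ?thesis using e(2)[of y] y x by simp
    qed
    moreover have "min d e > 0" using d e(1) by simp
    ultimately show "\<exists>\<delta>>0. \<forall>y\<in>carrier_vec (dim_vec x). euclid_norm (y - x) < \<delta> \<longrightarrow>
        euclid_norm (g y - g x - J *\<^sub>v (y - x)) \<le> \<epsilon> * euclid_norm (y - x)"
      by blast
  qed
qed

lemma has_jacobian_lipschitz:
  assumes J: "has_jacobian f J x"
  obtains L \<delta> where "L > 0" "\<delta> > 0"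
    "\<And>y. y \<in> carrier_vec (dim_vec x) \<Longrightarrow> euclid_norm (y - x) < \<delta> \<Longrightarrow>
       euclid_norm (f y - f x) \<le> L * euclid_norm (y - x)"
proof -
  note c = has_jacobian_carrier[OF J]
  obtain K where K: "K \<ge> 0"
    "\<And>v. v \<in> carrier_vec (dim_col J) \<Longrightarrow> euclid_norm (J *\<^sub>v v) \<le> K * euclid_norm v"
    using mult_mat_vec_bounded[of J] by blast
  obtain d where d: "d > 0"
    "\<And>y. y \<in> carrier_vec (dim_vec x) \<Longrightarrow> euclid_norm (y - x) < d \<Longrightarrow>
       euclid_norm (f y - f x - J *\<^sub>v (y - x)) \<le> 1 * euclid_norm (y - x)"
    using has_jacobianE[OF J, of 1] by auto
  have "euclid_norm (f y - f x) \<le> (1 + K) * euclid_norm (y - x)"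
    if y: "y \<in> carrier_vec (dim_vec x)" "euclid_norm (y - x) < d" for y
  proof -
    have yx: "y - x \<in> carrier_vec (dim_col J)" using c by (intro carrier_vecI) simp
    have "f y - f x = (f y - f x - J *\<^sub>v (y - x)) + J *\<^sub>v (y - x)"
      using c by (intro eq_vecI) auto
    also have "euclid_norm \<dots> \<le>
        euclid_norm (f y - f x - J *\<^sub>v (y - x)) + euclid_norm (J *\<^sub>v (y - x))"
      by (rule euclid_norm_triangle[of _ "dim_row J"]; rule carrier_vecI) simp_all
    also have "\<dots> \<le> 1 * euclid_norm (y - x) + K * euclid_norm (y - x)"
      using d(2)[OF y] K(2)[OF yx] by (intro add_mono)
    finally show ?thesis by (simp add: algebra_simps)
  qed
  with that[of "1 + K" d] K d show ?thesis by auto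
qed

lemma has_jacobian_compose:
  assumes f: "has_jacobian f A x" and g: "has_jacobian g B (f x)" and d0: "d0 > 0"
    and maps: "\<And>y. y \<in> carrier_vec (dim_vec x) \<Longrightarrow> euclid_norm (y - x) < d0 \<Longrightarrow>
      f y \<in> carrier_vec (dim_vec (f x))"
  shows "has_jacobian (\<lambda>y. g (f y)) (B * A) x"
  unfolding has_jacobian_def
proof (intro conjI allI impI)
  note cA = has_jacobian_carrier[OF f] and cB = has_jacobian_carrier[OF g]
  show "B * A \<in> carrier_mat (dim_vec (g (f x))) (dim_vec x)" using cA cB by auto
  fix \<epsilon> :: real assume \<epsilon>: "\<epsilon> > 0"
  obtain K where K: "K \<ge> 0"
    "\<And>v. v \<in> carrier_vec (dim_col B) \<Longrightarrow> euclid_norm (B *\<^sub>v v) \<le> K * euclid_norm v"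
    using mult_mat_vec_bounded[of B] by blast
  obtain L d1 where L: "L > 0" "d1 > 0"
    "\<And>y. y \<in> carrier_vec (dim_vec x) \<Longrightarrow> euclid_norm (y - x) < d1 \<Longrightarrow>
       euclid_norm (f y - f x) \<le> L * euclid_norm (y - x)"
    using has_jacobian_lipschitz[OF f] by blast
  define e1 where "e1 = \<epsilon> / (2 * (K + 1))"
  define e2 where "e2 = \<epsilon> / (2 * L)"
  have e: "e1 > 0" "e2 > 0" using \<epsilon> K L by (auto simp: e1_def e2_def)
  have e_sum: "e2 * L + K * e1 \<le> \<epsilon>"
    using \<epsilon> K L by (simp add: e1_def e2_def field_simps)
  obtain d2 where d2: "d2 > 0"
    "\<And>y. y \<in> carrier_vec (dim_vec x) \<Longrightarrow> euclid_norm (y - x) < d2 \<Longrightarrow>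
       euclid_norm (f y - f x - A *\<^sub>v (y - x)) \<le> e1 * euclid_norm (y - x)"
    using has_jacobianE[OF f e(1)] by blast
  obtain d3 where d3: "d3 > 0"
    "\<And>y. y \<in> carrier_vec (dim_vec (f x)) \<Longrightarrow> euclid_norm (y - f x) < d3 \<Longrightarrow>
       euclid_norm (g y - g (f x) - B *\<^sub>v (y - f x)) \<le> e2 * euclid_norm (y - f x)"
    using has_jacobianE[OF g e(2)] by blast
  define \<delta> where "\<delta> = Min {d0, d1, d2, d3 / L}"
  have "\<delta> > 0" using d0 d2 d3 L by (simp add: \<delta>_def)
  moreover have "euclid_norm (g (f y) - g (f x) - (B * A) *\<^sub>v (y - x)) \<le> \<epsilon> * euclid_norm (y - x)"
    if y: "y \<in> carrier_vec (dim_vec x)" and lt: "euclid_norm (y - x) < \<delta>" for y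
  proof -
    let ?r = "euclid_norm (y - x)"
    have r: "?r < d0" "?r < d1" "?r < d2" "?r < d3 / L" using lt by (auto simp: \<delta>_def)
    have fy: "f y \<in> carrier_vec (dim_vec (f x))" using maps y r by blast
    have fl: "euclid_norm (f y - f x) \<le> L * ?r" using L y r by blast
    also have "\<dots> < d3" using r(4) L by (simp add: field_simps)
    finally have fd: "euclid_norm (f y - f x) < d3" .
    define u where "u = f y - f x - A *\<^sub>v (y - x)"
    define w where "w = g (f y) - g (f x) - B *\<^sub>v (f y - f x)"
    have yx: "y - x \<in> carrier_vec (dim_vec x)" by (intro carrier_vecI) simp
    have Ayx: "A *\<^sub>v (y - x) \<in> carrier_vec (dim_vec (f x))"
      using cA yx by (rule mult_mat_vec_carrier)
    have u: "u \<in> carrier_vec (dim_vec (f x))"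
      unfolding u_def using fy Ayx by (intro minus_carrier_vec carrier_vec_dim_vec)
    have w: "w \<in> carrier_vec (dim_vec (g (f x)))"
      using cB by (intro carrier_vecI) (simp add: w_def)
    have "f y - f x = u + A *\<^sub>v (y - x)"
      using cA by (intro eq_vecI) (auto simp: u_def)
    then have "B *\<^sub>v (f y - f x) = B *\<^sub>v (u + A *\<^sub>v (y - x))" by (rule arg_cong)
    also have "\<dots> = B *\<^sub>v u + (B * A) *\<^sub>v (y - x)"
      unfolding mult_add_distrib_mat_vec[OF cB u Ayx] assoc_mult_mat_vec[OF cB cA yx] ..
    finally have Bf: "B *\<^sub>v (f y - f x) = B *\<^sub>v u + (B * A) *\<^sub>v (y - x)" .
    have "w = g (f y) - g (f x) - (B *\<^sub>v u + (B * A) *\<^sub>v (y - x))"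
      unfolding w_def Bf ..
    then have "g (f y) - g (f x) - (B * A) *\<^sub>v (y - x) = w + B *\<^sub>v u"
      using cA cB by (intro eq_vecI) (auto simp del: index_mult_mat_vec)
    also have "euclid_norm \<dots> \<le> euclid_norm w + euclid_norm (B *\<^sub>v u)"
      using w cB u by (intro euclid_norm_triangle) auto
    also have "\<dots> \<le> e2 * euclid_norm (f y - f x) + K * euclid_norm u"
      using d3(2)[OF fy fd] K(2)[of u] u cB by (intro add_mono) (auto simp: w_def)
    also have "\<dots> \<le> e2 * (L * ?r) + K * (e1 * ?r)"
      using fl d2(2)[OF y r(3)] e K by (intro add_mono mult_left_mono) (auto simp: u_def)
    also have "\<dots> = (e2 * L + K * e1) * ?r" by (simp add: algebra_simps)
    also have "\<dots> \<le> \<epsilon> * ?r" using e_sum by (intro mult_right_mono) auto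
    finally show ?thesis .
  qed
  ultimately show "\<exists>\<delta>>0. \<forall>y\<in>carrier_vec (dim_vec x). euclid_norm (y - x) < \<delta> \<longrightarrow>
      euclid_norm (g (f y) - g (f x) - (B * A) *\<^sub>v (y - x)) \<le> \<epsilon> * euclid_norm (y - x)"
    by blast
qed

lemma has_jacobian_translate:
  assumes "z \<in> carrier_vec n" "x \<in> carrier_vec n"
  shows "has_jacobian (\<lambda>y. y - z) (1\<^sub>m n) x"
proof -
  have "euclid_norm (y - z - (x - z) - 1\<^sub>m n *\<^sub>v (y - x)) = 0" if "y \<in> carrier_vec n" for y
  proof -
    have "y - z - (x - z) - 1\<^sub>m n *\<^sub>v (y - x) = 0\<^sub>v n"
      using assms that by (intro eq_vecI) auto
    then show ?thesis by simp
  qed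
  then show ?thesis using assms
    by (auto simp: has_jacobian_def intro!: exI[of _ "1::real"])
qed

section \<open>The Jacobians of the implicit Euler steps\<close>

lemma differentiable_field_slice:
  assumes G: "differentiable_field n G" and x: "x \<in> carrier_vec n"
  obtains J where "J \<in> carrier_mat n n" "has_jacobian (G s) J x"
proof -
  let ?f = "\<lambda>q. G (q $ 0) (vec n (\<lambda>i. q $ Suc i))"
  define p where "p y = vec (Suc n) (case_nat s (\<lambda>i. y $ i))" for y
  have p: "p y \<in> carrier_vec (Suc n)" for y by (simp add: p_def)
  have fp: "?f (p y) = G s y" if "y \<in> carrier_vec n" for y
  proof -
    have "vec n (\<lambda>i. p y $ Suc i) = y" using that by (intro eq_vecI) (auto simp: p_def)
    moreover have "p y $ 0 = s" by (simp add: p_def)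
    ultimately show ?thesis by simp
  qed
  have Gx: "G s x \<in> carrier_vec n" using G x by (auto simp: differentiable_field_def)
  from G p obtain J where J: "has_jacobian ?f J (p x)"
    unfolding differentiable_field_def differentiable_vec_def by blast
  have cJ: "J \<in> carrier_mat n (Suc n)"
    using has_jacobian_carrier[OF J] fp[OF x] Gx p[of x] by simp
  define J' where "J' = mat n n (\<lambda>(i, j). J $$ (i, Suc j))"
  have J': "J' \<in> carrier_mat n n" by (simp add: J'_def)
  have norm: "euclid_norm (p y - p x) = euclid_norm (y - x)" if "y \<in> carrier_vec n" for y
  proof -
    have "euclid_norm (p y - p x) = sqrt (\<Sum>i<Suc n. ((p y - p x) $ i)\<^sup>2)"
      by (simp add: euclid_norm_def L2_set_def p_def)
    also have "(\<Sum>i<Suc n. ((p y - p x) $ i)\<^sup>2) = (\<Sum>i<n. ((y - x) $ i)\<^sup>2)"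
      using x by (subst sum.lessThan_Suc_shift) (simp add: p_def)
    finally show ?thesis using x by (simp add: euclid_norm_def L2_set_def)
  qed
  have app: "J *\<^sub>v (p y - p x) = J' *\<^sub>v (y - x)" if "y \<in> carrier_vec n" for y
  proof (rule eq_vecI)
    fix i assume "i < dim_vec (J' *\<^sub>v (y - x))"
    then have i: "i < n" using J' by simp
    have "(J *\<^sub>v (p y - p x)) $ i = (\<Sum>j<Suc n. J $$ (i, j) * (p y - p x) $ j)"
      using i cJ p[of x] p[of y] by (simp add: scalar_prod_def atLeast0LessThan del: sum.lessThan_Suc)
    also have "\<dots> = (\<Sum>j<n. J $$ (i, Suc j) * (y - x) $ j)"
      using x by (subst sum.lessThan_Suc_shift) (simp add: p_def)
    also have "\<dots> = (J' *\<^sub>v (y - x)) $ i"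
      using i x by (simp add: scalar_prod_def atLeast0LessThan J'_def)
    finally show "(J *\<^sub>v (p y - p x)) $ i = (J' *\<^sub>v (y - x)) $ i" .
  qed (use cJ J' in auto)
  have "has_jacobian (G s) J' x"
    unfolding has_jacobian_def
  proof (intro conjI allI impI)
    show "J' \<in> carrier_mat (dim_vec (G s x)) (dim_vec x)" using J' Gx x by simp
    fix \<epsilon> :: real assume "\<epsilon> > 0"
    from has_jacobianE[OF J this] obtain d where d: "d > 0"
      "\<And>q. q \<in> carrier_vec (dim_vec (p x)) \<Longrightarrow> euclid_norm (q - p x) < d \<Longrightarrow>
        euclid_norm (?f q - ?f (p x) - J *\<^sub>v (q - p x)) \<le> \<epsilon> * euclid_norm (q - p x)"
      by blast
    have "euclid_norm (G s y - G s x - J' *\<^sub>v (y - x)) \<le> \<epsilon> * euclid_norm (y - x)"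
      if y: "y \<in> carrier_vec n" "euclid_norm (y - x) < d" for y
      using d(2)[of "p y"] y fp[OF x] fp[OF y(1)] norm[OF y(1)] app[OF y(1)] p[of x] p[of y]
      by simp
    with d(1) x show "\<exists>\<delta>>0. \<forall>y\<in>carrier_vec (dim_vec x). euclid_norm (y - x) < \<delta> \<longrightarrow>
        euclid_norm (G s y - G s x - J' *\<^sub>v (y - x)) \<le> \<epsilon> * euclid_norm (y - x)"
      by auto
  qed
  with that J' show ?thesis by blast
qed

lemma euler_residual_has_jacobian:
  assumes G: "differentiable_field n G" and x: "x \<in> carrier_vec n" and z: "z \<in> carrier_vec n"
  obtains A where "A \<in> carrier_mat n n" "has_jacobian (\<lambda>y. euler_residual G i y z dt) A x"
proof -
  let ?s = "real i * dt"
  obtain J where J: "J \<in> carrier_mat n n" "has_jacobian (G ?s) J x"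
    using differentiable_field_slice[OF G x] by blast
  have Gc: "G ?s y \<in> carrier_vec n" if "y \<in> carrier_vec n" for y
    using G that by (auto simp: differentiable_field_def)
  define A where "A = 1\<^sub>m n - dt \<cdot>\<^sub>m J"
  have A: "A \<in> carrier_mat n n" unfolding A_def using J(1) by (intro minus_carrier_mat smult_carrier_mat)
  have eq: "euler_residual G i y z dt - euler_residual G i x z dt - A *\<^sub>v (y - x) =
      (- dt) \<cdot>\<^sub>v (G ?s y - G ?s x - J *\<^sub>v (y - x))" if y: "y \<in> carrier_vec n" for y
  proof -
    have yx: "y - x \<in> carrier_vec n" using x y by simp
    have "A *\<^sub>v (y - x) = (y - x) - dt \<cdot>\<^sub>v (J *\<^sub>v (y - x))"
    proof -
      have "(dt \<cdot>\<^sub>m J) *\<^sub>v (y - x) = dt \<cdot>\<^sub>v (J *\<^sub>v (y - x))"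
        using J yx by (intro eq_vecI) (auto simp: smult_scalar_prod_distrib[of _ n])
      then show ?thesis
        unfolding A_def using J yx by (simp add: minus_mult_distrib_mat_vec[of _ n n])
    qed
    then show ?thesis using J x y z Gc[OF x] Gc[OF y]
      by (intro eq_vecI) (auto simp: euler_residual_def algebra_simps simp del: index_mult_mat_vec)
  qed
  have dim: "dim_vec (euler_residual G i x z dt) = n"
    using Gc[OF x] by (simp add: euler_residual_def)
  have "has_jacobian (\<lambda>y. euler_residual G i y z dt) A x"
    unfolding has_jacobian_def
  proof (intro conjI allI impI)
    show "A \<in> carrier_mat (dim_vec (euler_residual G i x z dt)) (dim_vec x)" using A x dim by simp
    fix \<epsilon> :: real assume \<epsilon>: "\<epsilon> > 0"
    then have "\<epsilon> / (\<bar>dt\<bar> + 1) > 0" by (simp add: add_nonneg_pos)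
    from has_jacobianE[OF J(2) this] obtain d where d: "d > 0"
      "\<And>y. y \<in> carrier_vec (dim_vec x) \<Longrightarrow> euclid_norm (y - x) < d \<Longrightarrow>
        euclid_norm (G ?s y - G ?s x - J *\<^sub>v (y - x)) \<le> \<epsilon> / (\<bar>dt\<bar> + 1) * euclid_norm (y - x)"
      by blast
    have "euclid_norm (euler_residual G i y z dt - euler_residual G i x z dt - A *\<^sub>v (y - x))
        \<le> \<epsilon> * euclid_norm (y - x)"
      if y: "y \<in> carrier_vec n" "euclid_norm (y - x) < d" for y
    proof -
      have "euclid_norm (euler_residual G i y z dt - euler_residual G i x z dt - A *\<^sub>v (y - x))
          \<le> \<bar>dt\<bar> * (\<epsilon> / (\<bar>dt\<bar> + 1) * euclid_norm (y - x))"
        unfolding eq[OF y(1)] euclid_norm_smult abs_minus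
        using d(2) y x by (intro mult_left_mono) auto
      also have "\<dots> = (\<bar>dt\<bar> * (\<epsilon> / (\<bar>dt\<bar> + 1))) * euclid_norm (y - x)" by simp
      also have "\<dots> \<le> \<epsilon> * euclid_norm (y - x)"
        using \<epsilon> by (intro mult_right_mono) (auto simp: field_simps add_nonneg_pos)
      finally show ?thesis .
    qed
    with d(1) x show "\<exists>\<delta>>0. \<forall>y\<in>carrier_vec (dim_vec x). euclid_norm (y - x) < \<delta> \<longrightarrow>
        euclid_norm (euler_residual G i y z dt - euler_residual G i x z dt - A *\<^sub>v (y - x))
          \<le> \<epsilon> * euclid_norm (y - x)"
      by auto
  qed
  with that A show ?thesis by blast
qed

lemma open_in_spaceE:
  assumes "open_in_space n U" "x \<in> U"
  obtains d where "d > 0" "\<And>y. y \<in> carrier_vec n \<Longrightarrow> euclid_norm (y - x) < d \<Longrightarrow> y \<in> U"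
  using assms unfolding open_in_space_def by blast

lemma implicit_euler_step_jacobian:
  assumes ie: "implicit_euler n m dt G x U \<phi>" and G: "differentiable_field n G"
    and i: "i \<in> {1..m}"
  obtains A B where "A \<in> carrier_mat n n" "B \<in> carrier_mat n n"
    "jacobian (\<lambda>y. euler_residual G i y (x (i - 1)) dt) (x i) = A"
    "has_jacobian (\<phi> i) B (x (i - 1))" "B * A = 1\<^sub>m n"
proof -
  let ?z = "x (i - 1)"
  let ?R = "\<lambda>y. euler_residual G i y ?z dt"
  have x: "x i \<in> carrier_vec n" "?z \<in> carrier_vec n"
    using ie i by (auto simp: implicit_euler_def)
  have U: "open_in_space n (U (i - 1))" "?z \<in> U (i - 1)" "\<phi> i ` U (i - 1) \<subseteq> carrier_vec n"
    "differentiable_vec (\<phi> i) ?z" "\<phi> i ?z = x i"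
    "\<And>z. z \<in> U (i - 1) \<Longrightarrow> euler_residual G i (\<phi> i z) z dt = 0\<^sub>v n"
    using ie i by (auto simp: implicit_euler_def)
  obtain A where A: "A \<in> carrier_mat n n" "has_jacobian ?R A (x i)"
    using euler_residual_has_jacobian[OF G x] by blast
  obtain B where B: "has_jacobian (\<phi> i) B ?z"
    using U(4) by (auto simp: differentiable_vec_def)
  have cB: "B \<in> carrier_mat n n" using has_jacobian_carrier[OF B] U(5) x by simp
  obtain d where d: "d > 0"
    "\<And>y. y \<in> carrier_vec n \<Longrightarrow> euclid_norm (y - ?z) < d \<Longrightarrow> y \<in> U (i - 1)"
    using open_in_spaceE[OF U(1,2)] by blast
  have "has_jacobian (\<lambda>z. ?R (\<phi> i z)) (A * B) ?z"
    using B A U(3,5) d x by (intro has_jacobian_compose[of _ _ _ _ _ d]) auto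
  moreover have "has_jacobian (\<lambda>z. ?R (\<phi> i z)) (1\<^sub>m n) ?z"
  proof (rule has_jacobian_transform[OF has_jacobian_translate[OF x(2) x(2)] d(1)])
    fix y assume y: "y \<in> carrier_vec (dim_vec ?z)" "euclid_norm (y - ?z) < d"
    then have yc: "y \<in> carrier_vec n" and yU: "y \<in> U (i - 1)" using d x by auto
    have py: "\<phi> i y \<in> carrier_vec n" using U(3) yU by auto
    have Gy: "G (real i * dt) (\<phi> i y) \<in> carrier_vec n"
      using G py by (auto simp: differentiable_field_def)
    show "y - ?z = ?R (\<phi> i y)"
    proof (rule eq_vecI)
      fix k assume "k < dim_vec (?R (\<phi> i y))"
      then have k: "k < n" using Gy by (simp add: euler_residual_def)
      have "euler_residual G i (\<phi> i y) y dt $ k = 0" using U(6)[OF yU] k by simp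
      then show "(y - ?z) $ k = ?R (\<phi> i y) $ k"
        using k yc py Gy x by (simp add: euler_residual_def)
    qed (use Gy x in \<open>simp add: euler_residual_def\<close>)
  qed
  ultimately have "A * B = 1\<^sub>m n" by (rule has_jacobian_unique)
  then have "B * A = 1\<^sub>m n" using mat_mult_left_right_inverse[OF A(1) cB] by simp
  with that A(1) cB jacobian_eqI[OF A(2)] B show ?thesis by blast
qed

lemma has_jacobian_euler_map:
  assumes ie: "implicit_euler n m dt G x U \<phi>"
    and B: "\<And>i. i \<in> {1..m} \<Longrightarrow> has_jacobian (\<phi> i) (B i) (x (i - 1))"
    and "k \<le> m"
  shows "\<exists>d>0. has_jacobian (euler_map \<phi> k) (rec_nat (1\<^sub>m n) (\<lambda>i M. B (Suc i) * M) k) (x 0) \<and>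
    euler_map \<phi> k (x 0) = x k \<and>
    (\<forall>y\<in>carrier_vec n. euclid_norm (y - x 0) < d \<longrightarrow> euler_map \<phi> k y \<in> carrier_vec n)"
  using \<open>k \<le> m\<close>
proof (induction k)
  case 0
  have x0: "x 0 \<in> carrier_vec n" using ie by (auto simp: implicit_euler_def)
  have "has_jacobian (\<lambda>y. y) (1\<^sub>m n) (x 0)"
    by (rule has_jacobian_transform[OF has_jacobian_translate[of "0\<^sub>v n" n "x 0"], of 1])
      (use x0 in auto)
  moreover have "euler_map \<phi> 0 = (\<lambda>y. y)" by auto
  ultimately show ?case by (auto intro!: exI[of _ "1::real"])
next
  case (Suc k)
  let ?J = "rec_nat (1\<^sub>m n) (\<lambda>i M. B (Suc i) * M)"
  obtain d where d: "d > 0" "has_jacobian (euler_map \<phi> k) (?J k) (x 0)" "euler_map \<phi> k (x 0) = x k"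
    "\<And>y. y \<in> carrier_vec n \<Longrightarrow> euclid_norm (y - x 0) < d \<Longrightarrow> euler_map \<phi> k y \<in> carrier_vec n"
    using Suc by auto
  have x: "x 0 \<in> carrier_vec n" "x k \<in> carrier_vec n"
    using ie Suc.prems by (auto simp: implicit_euler_def)
  have Sk: "Suc k \<in> {1..m}" using Suc.prems by simp
  have U: "open_in_space n (U k)" "x k \<in> U k" "\<phi> (Suc k) ` U k \<subseteq> carrier_vec n"
    "\<phi> (Suc k) (x k) = x (Suc k)"
    using ie Sk unfolding implicit_euler_def by (metis diff_Suc_1)+
  obtain e where e: "e > 0" "\<And>y. y \<in> carrier_vec n \<Longrightarrow> euclid_norm (y - x k) < e \<Longrightarrow> y \<in> U k"
    using open_in_spaceE[OF U(1,2)] by blast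
  obtain L d1 where L: "L > 0" "d1 > 0"
    "\<And>y. y \<in> carrier_vec (dim_vec (x 0)) \<Longrightarrow> euclid_norm (y - x 0) < d1 \<Longrightarrow>
       euclid_norm (euler_map \<phi> k y - euler_map \<phi> k (x 0)) \<le> L * euclid_norm (y - x 0)"
    using has_jacobian_lipschitz[OF d(2)] by blast
  have "euler_map \<phi> (Suc k) = (\<lambda>y. \<phi> (Suc k) (euler_map \<phi> k y))" by auto
  then have "has_jacobian (euler_map \<phi> (Suc k)) (?J (Suc k)) (x 0)"
    using has_jacobian_compose[OF d(2), of "\<phi> (Suc k)" "B (Suc k)" d] d B[OF Sk] x by simp
  moreover have "euler_map \<phi> (Suc k) y \<in> carrier_vec n"
    if y: "y \<in> carrier_vec n" "euclid_norm (y - x 0) < Min {d, d1, e / L}" for y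
  proof -
    have "euclid_norm (euler_map \<phi> k y - x k) \<le> L * euclid_norm (y - x 0)"
      using L(3)[of y] y x d(3) by simp
    also have "\<dots> < e" using y(2) L(1) by (simp add: field_simps)
    finally have "euler_map \<phi> k y \<in> U k" using e(2) d(4) y by simp
    then show ?thesis using U(3) by auto
  qed
  moreover have "euler_map \<phi> (Suc k) (x 0) = x (Suc k)" using d(3) U(4) by simp
  moreover have "Min {d, d1, e / L} > 0" using d(1) L(1,2) e(1) by simp
  ultimately show ?case by blast
qed

lemma foldr_mult_mat_vec_carrier:
  assumes "set As \<subseteq> carrier_mat n n" "v \<in> carrier_vec n"
  shows "foldr (\<lambda>A w. A *\<^sub>v w) As v \<in> carrier_vec n"
  using assms by (induction As) (auto intro!: mult_mat_vec_carrier)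

lemma euler_map_inverse_jacobian:
  assumes ie: "implicit_euler n m dt G x U \<phi>" and G: "differentiable_field n G"
    and inv: "differentially_invertible (euler_map \<phi> m) (x 0)"
  shows "set (stored_matrices G m dt x) \<subseteq> carrier_mat n n"
    and "v \<in> carrier_vec n \<Longrightarrow> the (mat_inverse (jacobian (euler_map \<phi> m) (x 0))) *\<^sub>v v =
      foldr (\<lambda>A w. A *\<^sub>v w) (stored_matrices G m dt x) v"
proof -
  define A where "A i = jacobian (\<lambda>y. euler_residual G i y (x (i - 1)) dt) (x i)" for i
  have "\<forall>i\<in>{1..m}. \<exists>B. A i \<in> carrier_mat n n \<and> B \<in> carrier_mat n n \<and>
      has_jacobian (\<phi> i) B (x (i - 1)) \<and> B * A i = 1\<^sub>m n"
    unfolding A_def by (metis implicit_euler_step_jacobian[OF ie G])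
  then obtain B where AB: "\<And>i. i \<in> {1..m} \<Longrightarrow> A i \<in> carrier_mat n n"
    "\<And>i. i \<in> {1..m} \<Longrightarrow> B i \<in> carrier_mat n n"
    "\<And>i. i \<in> {1..m} \<Longrightarrow> has_jacobian (\<phi> i) (B i) (x (i - 1))"
    "\<And>i. i \<in> {1..m} \<Longrightarrow> B i * A i = 1\<^sub>m n"
    by metis
  let ?J = "rec_nat (1\<^sub>m n) (\<lambda>i M. B (Suc i) * M)"
  have As: "stored_matrices G m dt x = map A [1..<Suc m]"
    by (simp add: stored_matrices_def A_def)
  show carr: "set (stored_matrices G m dt x) \<subseteq> carrier_mat n n"
    using AB(1) by (auto simp: As)
  have J: "jacobian (euler_map \<phi> m) (x 0) = ?J m"
    using has_jacobian_euler_map[OF ie AB(3), of m] jacobian_eqI by blast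
  have cJ: "?J k \<in> carrier_mat n n" if "k \<le> m" for k
    using that
  proof (induction k)
    case (Suc k)
    then show ?case using AB(2)[of "Suc k"] by (simp add: mult_carrier_mat[of _ n n])
  qed simp
  have id: "?J k *\<^sub>v foldr (\<lambda>A w. A *\<^sub>v w) (map A [1..<Suc k]) v = v"
    if "k \<le> m" "v \<in> carrier_vec n" for k v
    using that
  proof (induction k arbitrary: v)
    case (Suc k)
    then have i: "Suc k \<in> {1..m}" by auto
    let ?w = "foldr (\<lambda>A w. A *\<^sub>v w) (map A [1..<Suc k]) (A (Suc k) *\<^sub>v v)"
    have Av: "A (Suc k) *\<^sub>v v \<in> carrier_vec n" using AB(1)[OF i] Suc.prems by auto
    have w: "?w \<in> carrier_vec n"
      using AB(1) Suc.prems(1) Av by (intro foldr_mult_mat_vec_carrier) auto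
    have "?J (Suc k) *\<^sub>v foldr (\<lambda>A w. A *\<^sub>v w) (map A [1..<Suc (Suc k)]) v
        = (B (Suc k) * ?J k) *\<^sub>v ?w" by simp
    also have "\<dots> = B (Suc k) *\<^sub>v (?J k *\<^sub>v ?w)"
      using AB(2)[OF i] cJ Suc.prems(1) w by (intro assoc_mult_mat_vec) auto
    also have "\<dots> = B (Suc k) *\<^sub>v (A (Suc k) *\<^sub>v v)" using Suc.IH[OF _ Av] Suc.prems(1) by simp
    also have "\<dots> = v"
      using AB(1,2,4)[OF i] Suc.prems(2) by (simp flip: assoc_mult_mat_vec)
    finally show ?case .
  qed auto
  have Jc: "?J m \<in> carrier_mat n n" using cJ by simp
  obtain M where M: "M * ?J m = 1\<^sub>m n" "?J m * M = 1\<^sub>m n" "M \<in> carrier_mat n n"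
  proof -
    from inv J have "invertible_mat (?J m)" by (simp add: differentially_invertible_def)
    then obtain M where M: "inverts_mat (?J m) M" "inverts_mat M (?J m)"
      by (auto simp: invertible_mat_def)
    have JM: "?J m * M = 1\<^sub>m n" using M(1) Jc by (simp add: inverts_mat_def)
    have MJ: "M * ?J m = 1\<^sub>m (dim_row M)" using M(2) by (simp add: inverts_mat_def)
    have "dim_col M = n" using arg_cong[OF JM, of dim_col] by simp
    moreover have "dim_row M = n" using arg_cong[OF MJ, of dim_col] Jc by simp
    ultimately show ?thesis using that JM MJ by auto
  qed
  have "?J m \<in> Units (ring_mat TYPE(real) n ())"
    unfolding Units_def using M Jc by (auto simp: ring_mat_simps)
  then obtain N where N: "mat_inverse (?J m) = Some N"
    using mat_inverse(1)[OF Jc, of "()"] by (cases "mat_inverse (?J m)") auto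
  have NJ: "N * ?J m = 1\<^sub>m n" "N \<in> carrier_mat n n" using mat_inverse(2)[OF Jc N] by auto
  assume v: "v \<in> carrier_vec n"
  let ?w = "foldr (\<lambda>A w. A *\<^sub>v w) (stored_matrices G m dt x) v"
  have w: "?w \<in> carrier_vec n" using carr v by (rule foldr_mult_mat_vec_carrier)
  have "N *\<^sub>v v = N *\<^sub>v (?J m *\<^sub>v ?w)" using id[of m v] v by (simp add: As)
  also have "\<dots> = (N * ?J m) *\<^sub>v ?w" using assoc_mult_mat_vec[OF NJ(2) Jc w] by simp
  also have "\<dots> = ?w" using NJ w by simp
  finally show "the (mat_inverse (jacobian (euler_map \<phi> m) (x 0))) *\<^sub>v v = ?w"
    by (simp add: J N)
qed

section \<open>Straight-line programs for iterated matrix-vector products\<close>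

lemma length_fold_exec_instr: "length (fold exec_instr P mem) = length mem + length P"
proof (induction P arbitrary: mem)
  case (Cons a P)
  then show ?case by (cases a) auto
qed simp

lemma nth_fold_exec_instr: "a < length mem \<Longrightarrow> fold exec_instr P mem ! a = mem ! a"
proof (induction P arbitrary: mem)
  case (Cons b P)
  then show ?case by (cases b) (auto simp: nth_append)
qed simp

lemma valid_program_append:
  "valid_program k (P @ Q) outs \<longleftrightarrow> valid_program k P [] \<and> valid_program (k + length P) Q outs"
proof -
  have "(\<forall>l<length (P @ Q). valid_instr (k + l) ((P @ Q) ! l)) \<longleftrightarrow>
      (\<forall>l<length P. valid_instr (k + l) (P ! l)) \<and>
      (\<forall>l<length Q. valid_instr (k + length P + l) (Q ! l))" (is "?L \<longleftrightarrow> ?R")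
  proof
    assume L: ?L
    have "valid_instr (k + l) (P ! l)" if "l < length P" for l
      using L[rule_format, of l] that by (simp add: nth_append)
    moreover have "valid_instr (k + length P + l) (Q ! l)" if "l < length Q" for l
      using L[rule_format, of "length P + l"] that by (simp add: nth_append add.assoc)
    ultimately show ?R by blast
  next
    assume R: ?R
    show ?L
    proof (intro allI impI)
      fix l assume l: "l < length (P @ Q)"
      show "valid_instr (k + l) ((P @ Q) ! l)"
        using R[THEN conjunct1, rule_format, of l] R[THEN conjunct2, rule_format, of "l - length P"] l
        by (cases "l < length P") (auto simp: nth_append)
    qed
  qed
  then show ?thesis by (simp add: valid_program_def add.assoc)
qed

lemma valid_program_weaken: "valid_program k P outs \<Longrightarrow> valid_program k P []"
  by (simp add: valid_program_def)

lemma run_program_append: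
  "run_program (P @ Q) outs mem = run_program Q outs (fold exec_instr P mem)"
  by (simp add: run_program_def)

lemma dot_product_program:
  assumes "ps \<noteq> []" "\<forall>(i, j)\<in>set ps. i < k \<and> j < k"
  shows "\<exists>P a. valid_program k P [a] \<and> length P \<le> 2 * length ps \<and>
    (\<forall>mem. length mem = k \<longrightarrow>
      run_program P [a] mem = [\<Sum>(i, j)\<leftarrow>ps. mem ! i * mem ! j])"
  using assms
proof (induction ps rule: list_nonempty_induct)
  case (single p)
  obtain i j where p: "p = (i, j)" by (cases p)
  show ?case using single p
    by (intro exI[of _ "[Mul i j]"] exI[of _ k])
      (auto simp: valid_program_def run_program_def nth_append)
next
  case (cons p ps)
  obtain i j where p: "p = (i, j)" "i < k" "j < k" using cons.prems by (cases p) auto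
  obtain P a where P: "valid_program k P [a]" "length P \<le> 2 * length ps"
    "\<And>mem. length mem = k \<Longrightarrow> run_program P [a] mem = [\<Sum>(i, j)\<leftarrow>ps. mem ! i * mem ! j]"
    using cons by auto
  let ?Q = "[Mul i j, Add (k + length P) a]"
  have a: "a < k + length P" using P(1) by (simp add: valid_program_def)
  have "valid_program (k + length P) ?Q [Suc (k + length P)]"
    using p a by (auto simp: valid_program_def less_Suc_eq nth_Cons split: nat.split)
  then have "valid_program k (P @ ?Q) [Suc (k + length P)]"
    using P(1) valid_program_weaken by (auto simp: valid_program_append)
  moreover have "run_program (P @ ?Q) [Suc (k + length P)] mem =
      [\<Sum>(i, j)\<leftarrow>p # ps. mem ! i * mem ! j]" if m: "length mem = k" for mem
  proof -
    have "fold exec_instr P mem ! a = (\<Sum>(i, j)\<leftarrow>ps. mem ! i * mem ! j)"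
      using P(3)[OF m] by (simp add: run_program_def)
    then show ?thesis
      using p m a unfolding run_program_append
      by (simp add: run_program_def nth_append length_fold_exec_instr nth_fold_exec_instr)
  qed
  ultimately show ?case using P(2)
    by (intro exI[of _ "P @ ?Q"] exI[of _ "Suc (k + length P)"]) auto
qed

lemma run_program_extend:
  assumes "valid_program k P outs" "length mem = k"
  shows "run_program (P @ Q) outs mem = run_program P outs mem"
  using assms
  by (auto simp: run_program_def valid_program_def length_fold_exec_instr nth_fold_exec_instr)

definition list_mat_vec :: "real list list \<Rightarrow> real list \<Rightarrow> real list" where
  "list_mat_vec Rs w = map (\<lambda>r. sum_list (map2 (*) r w)) Rs"

text \<open>
  Below, the entries of \<open>Rs\<close>, \<open>Ms\<close> and \<open>bs\<close> are memory addresses; applying \<^term>\<open>(!) mem\<close> to them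
  yields the actual matrices and vectors.
\<close>

lemma mat_vec_program:
  assumes "n \<ge> 1" "\<forall>r\<in>set Rs. length r = n \<and> set r \<subseteq> {..<k}" "length bs = n" "set bs \<subseteq> {..<k}"
  shows "\<exists>P outs. valid_program k P outs \<and> length P \<le> length Rs * (2 * n) \<and>
    (\<forall>mem. length mem = k \<longrightarrow>
      run_program P outs mem = list_mat_vec (map (map ((!) mem)) Rs) (map ((!) mem) bs))"
  using assms
proof (induction Rs)
  case Nil
  show ?case by (intro exI[of _ "[]"]) (simp add: valid_program_def run_program_def list_mat_vec_def)
next
  case (Cons r Rs)
  obtain P outs where P: "valid_program k P outs" "length P \<le> length Rs * (2 * n)"
    "\<And>mem. length mem = k \<Longrightarrow>
      run_program P outs mem = list_mat_vec (map (map ((!) mem)) Rs) (map ((!) mem) bs)"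
    using Cons by auto
  let ?k = "k + length P"
  have ne: "zip r bs \<noteq> []" using Cons.prems by (cases r; cases bs) auto
  have zip_lt: "i < k" "j < k" if "(i, j) \<in> set (zip r bs)" for i j
    using set_zip_leftD[OF that] set_zip_rightD[OF that] Cons.prems by auto
  then have addr: "\<forall>(i, j)\<in>set (zip r bs). i < ?k \<and> j < ?k" by (auto intro: trans_less_add1)
  obtain Q a where Q: "valid_program ?k Q [a]" "length Q \<le> 2 * length (zip r bs)"
    "\<And>mem. length mem = ?k \<Longrightarrow> run_program Q [a] mem = [\<Sum>(i, j)\<leftarrow>zip r bs. mem ! i * mem ! j]"
    using dot_product_program[OF ne addr] by blast
  have "valid_program k (P @ Q) (a # outs)"
    using P(1) Q(1) valid_program_weaken[OF P(1)] unfolding valid_program_append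
    by (auto simp: valid_program_def)
  moreover have "length (P @ Q) \<le> length (r # Rs) * (2 * n)"
    using P(2) Q(2) Cons.prems by simp
  moreover have "run_program (P @ Q) (a # outs) mem =
      list_mat_vec (map (map ((!) mem)) (r # Rs)) (map ((!) mem) bs)" if m: "length mem = k" for mem
  proof -
    let ?mem = "fold exec_instr P mem"
    have mem': "length ?mem = ?k" using m by (simp add: length_fold_exec_instr)
    have mem_eq: "map2 (\<lambda>i j. ?mem ! i * ?mem ! j) r bs = map2 (\<lambda>i j. mem ! i * mem ! j) r bs"
      using m zip_lt by (auto simp: nth_fold_exec_instr)
    have addr_eq: "map2 (*) (map ((!) mem) r) (map ((!) mem) bs) = map2 (\<lambda>i j. mem ! i * mem ! j) r bs"
      by (simp add: zip_map_map case_prod_unfold)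
    have "run_program (P @ Q) [a] mem =
        [sum_list (map2 (*) (map ((!) mem) r) (map ((!) mem) bs))]"
      unfolding run_program_append Q(3)[OF mem'] mem_eq addr_eq ..
    moreover have "run_program (P @ Q) (a # outs) mem =
        run_program (P @ Q) [a] mem @ run_program (P @ Q) outs mem"
      by (simp add: run_program_def)
    ultimately show ?thesis
      using run_program_extend[OF P(1) m, of Q] P(3)[OF m] by (simp add: list_mat_vec_def)
  qed
  ultimately show ?case by blast
qed

lemma iterated_mat_vec_program:
  assumes "n \<ge> 1" "\<forall>M\<in>set Ms. length M = n \<and> (\<forall>r\<in>set M. length r = n \<and> set r \<subseteq> {..<k})"
    "length bs = n" "set bs \<subseteq> {..<k}"
  shows "\<exists>P outs. valid_program k P outs \<and> length outs = n \<and> length P \<le> length Ms * (2 * n\<^sup>2) \<and>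
    (\<forall>mem. length mem = k \<longrightarrow>
      run_program P outs mem = foldr list_mat_vec (map (map (map ((!) mem))) Ms) (map ((!) mem) bs))"
  using assms
proof (induction Ms)
  case Nil
  then show ?case
    by (intro exI[of _ "[]"] exI[of _ bs]) (auto simp: valid_program_def run_program_def)
next
  case (Cons M Ms)
  obtain P outs where P: "valid_program k P outs" "length outs = n" "length P \<le> length Ms * (2 * n\<^sup>2)"
    "\<And>mem. length mem = k \<Longrightarrow>
      run_program P outs mem = foldr list_mat_vec (map (map (map ((!) mem))) Ms) (map ((!) mem) bs)"
    using Cons by auto
  let ?k = "k + length P"
  have M: "length M = n" "\<forall>r\<in>set M. length r = n \<and> set r \<subseteq> {..<k}" using Cons.prems by auto
  have "\<forall>r\<in>set M. length r = n \<and> set r \<subseteq> {..<?k}" using M by fastforce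
  moreover have "set outs \<subseteq> {..<?k}" using P(1) by (auto simp: valid_program_def)
  ultimately obtain Q outs' where Q: "valid_program ?k Q outs'" "length Q \<le> length M * (2 * n)"
    "\<And>mem. length mem = ?k \<Longrightarrow>
      run_program Q outs' mem = list_mat_vec (map (map ((!) mem)) M) (map ((!) mem) outs)"
    using mat_vec_program[of n M ?k outs] Cons.prems(1) P(2) by blast
  have "valid_program k (P @ Q) outs'"
    using Q(1) valid_program_weaken[OF P(1)] by (simp add: valid_program_append)
  moreover have "length (P @ Q) \<le> length (M # Ms) * (2 * n\<^sup>2)"
    using P(3) Q(2) M(1) by (simp add: power2_eq_square)
  moreover have "run_program (P @ Q) outs' mem =
      foldr list_mat_vec (map (map (map ((!) mem))) (M # Ms)) (map ((!) mem) bs)"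
    if m: "length mem = k" for mem
  proof -
    let ?mem = "fold exec_instr P mem"
    have mem': "length ?mem = ?k" using m by (simp add: length_fold_exec_instr)
    have M_eq: "map (map ((!) ?mem)) M = map (map ((!) mem)) M"
      using M m by (auto simp: nth_fold_exec_instr subset_iff)
    have outs_eq: "map ((!) ?mem) outs = run_program P outs mem" by (simp add: run_program_def)
    show ?thesis
      unfolding run_program_append Q(3)[OF mem'] M_eq outs_eq P(4)[OF m] by simp
  qed
  moreover have "length outs' = n"
  proof -
    have "length outs' = length (run_program Q outs' (replicate ?k 0))" by (simp add: run_program_def)
    also have "\<dots> = n" using Q(3)[of "replicate ?k 0"] M(1) by (simp add: list_mat_vec_def)
    finally show ?thesis .
  qed
  ultimately show ?case by blast
qed

section \<open>The memory layout\<close>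

lemma length_concat_uniform:
  "\<forall>xs\<in>set xss. length xs = n \<Longrightarrow> length (concat xss) = length xss * n"
  by (induction xss) auto

lemma nth_concat_uniform:
  assumes "\<forall>xs\<in>set xss. length xs = n" "i < length xss" "j < n"
  shows "concat xss ! (i * n + j) = xss ! i ! j"
  using assms
proof (induction xss arbitrary: i)
  case (Cons xs xss)
  then show ?case by (cases i) (auto simp: nth_append)
qed simp

lemma length_concat_mat_to_list:
  "A \<in> carrier_mat n n \<Longrightarrow> length (concat (mat_to_list A)) = n\<^sup>2"
  by (subst length_concat_uniform[of _ n]) (auto simp: mat_to_list_def power2_eq_square)

lemma length_matrix_data:
  assumes "set As \<subseteq> carrier_mat n n"
  shows "length (matrix_data As) = length As * n\<^sup>2"
  unfolding matrix_data_def using assms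
  by (subst length_concat_uniform[of _ "n\<^sup>2"]) (auto simp: length_concat_mat_to_list)

lemma nth_matrix_data:
  assumes As: "set As \<subseteq> carrier_mat n n" and l: "l < length As" and r: "r < n" and c: "c < n"
  shows "matrix_data As ! (l * n\<^sup>2 + (r * n + c)) = As ! l $$ (r, c)"
proof -
  have A: "As ! l \<in> carrier_mat n n" using As l by auto
  have "r * n + c < r * n + n" using c by simp
  also have "\<dots> \<le> n * n" using r by (metis Suc_leI add.commute mult_Suc mult_le_mono1)
  finally have "r * n + c < n\<^sup>2" by (simp add: power2_eq_square)
  then have "matrix_data As ! (l * n\<^sup>2 + (r * n + c)) = concat (mat_to_list (As ! l)) ! (r * n + c)"
    unfolding matrix_data_def using As l
    by (subst nth_concat_uniform) (auto simp: length_concat_mat_to_list)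
  also have "\<dots> = As ! l $$ (r, c)"
    using A r c by (subst nth_concat_uniform) (auto simp: mat_to_list_def)
  finally show ?thesis .
qed

lemma list_mat_vec_eq:
  assumes "A \<in> carrier_mat n n" "v \<in> carrier_vec n"
  shows "list_mat_vec (mat_to_list A) (list_of_vec v) = list_of_vec (A *\<^sub>v v)"
proof (rule nth_equalityI)
  show "length (list_mat_vec (mat_to_list A) (list_of_vec v)) = length (list_of_vec (A *\<^sub>v v))"
    by (simp add: list_mat_vec_def mat_to_list_def)
  fix i assume "i < length (list_mat_vec (mat_to_list A) (list_of_vec v))"
  then have i: "i < n" using assms by (simp add: list_mat_vec_def mat_to_list_def)
  then show "list_mat_vec (mat_to_list A) (list_of_vec v) ! i = list_of_vec (A *\<^sub>v v) ! i"
    using assms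
    by (simp add: list_mat_vec_def mat_to_list_def list_of_vec_index scalar_prod_def sum_list_sum_nth)
qed

lemma foldr_list_mat_vec_eq:
  assumes "set As \<subseteq> carrier_mat n n" "v \<in> carrier_vec n"
  shows "foldr list_mat_vec (map mat_to_list As) (list_of_vec v) =
    list_of_vec (foldr (\<lambda>A w. A *\<^sub>v w) As v)"
  using assms
proof (induction As)
  case (Cons A As)
  then show ?case
    using list_mat_vec_eq[of A n "foldr (\<lambda>A w. A *\<^sub>v w) As v"] foldr_mult_mat_vec_carrier[of As n v]
    by simp
qed simp

lemma iterated_product_program:
  assumes n: "n \<ge> 1"
  shows "\<exists>P outs. valid_program (m * n\<^sup>2 + n) P outs \<and> length P \<le> 2 * (m * n\<^sup>2) \<and>
    (\<forall>As v. length As = m \<longrightarrow> set As \<subseteq> carrier_mat n n \<longrightarrow> v \<in> carrier_vec n \<longrightarrow>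
      run_program P outs (matrix_data As @ list_of_vec v) =
        list_of_vec (foldr (\<lambda>A w. A *\<^sub>v w) As v))"
proof -
  let ?k = "m * n\<^sup>2 + n"
  define Ms where "Ms = map (\<lambda>l. map (\<lambda>r. map (\<lambda>c. l * n\<^sup>2 + (r * n + c)) [0..<n]) [0..<n]) [0..<m]"
  define bs where "bs = map (\<lambda>c. m * n\<^sup>2 + c) [0..<n]"
  have bound: "l * n\<^sup>2 + (r * n + c) < m * n\<^sup>2" if "l < m" "r < n" "c < n" for l r c
  proof -
    have "r * n + c < r * n + n" using that by simp
    also have "\<dots> \<le> n * n" using that by (metis Suc_leI add.commute mult_Suc mult_le_mono1)
    finally have "l * n\<^sup>2 + (r * n + c) < l * n\<^sup>2 + n\<^sup>2" by (simp add: power2_eq_square)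
    also have "\<dots> \<le> m * n\<^sup>2" using that by (metis Suc_leI add.commute mult_Suc mult_le_mono1)
    finally show ?thesis .
  qed
  have Ms: "\<forall>M\<in>set Ms. length M = n \<and> (\<forall>r\<in>set M. length r = n \<and> set r \<subseteq> {..<?k})"
    using bound by (auto simp: Ms_def intro: trans_less_add1)
  have bs: "length bs = n" "set bs \<subseteq> {..<?k}" by (auto simp: bs_def)
  obtain P outs where P: "valid_program ?k P outs" "length P \<le> length Ms * (2 * n\<^sup>2)"
    "\<And>mem. length mem = ?k \<Longrightarrow>
      run_program P outs mem = foldr list_mat_vec (map (map (map ((!) mem))) Ms) (map ((!) mem) bs)"
    using iterated_mat_vec_program[OF n Ms bs] by blast
  have "run_program P outs (matrix_data As @ list_of_vec v) =
      list_of_vec (foldr (\<lambda>A w. A *\<^sub>v w) As v)"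
    if As: "length As = m" "set As \<subseteq> carrier_mat n n" and v: "v \<in> carrier_vec n" for As v
  proof -
    let ?mem = "matrix_data As @ list_of_vec v"
    have len: "length (matrix_data As) = m * n\<^sup>2" using length_matrix_data[OF As(2)] As(1) by simp
    have "map (map (map ((!) ?mem))) Ms = map mat_to_list As"
    proof (rule nth_equalityI)
      fix l assume "l < length (map (map (map ((!) ?mem))) Ms)"
      then have l: "l < m" by (simp add: Ms_def)
      then have A: "As ! l \<in> carrier_mat n n" using As by auto
      show "map (map (map ((!) ?mem))) Ms ! l = map mat_to_list As ! l"
        using l A As bound
        by (auto simp: Ms_def mat_to_list_def nth_append len nth_matrix_data)
    qed (simp add: Ms_def As)
    moreover have "map ((!) ?mem) bs = list_of_vec v"
      using v by (intro nth_equalityI) (auto simp: bs_def nth_append len)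
    ultimately show ?thesis
      using P(3)[of ?mem] len v foldr_list_mat_vec_eq[OF As(2) v] by simp
  qed
  with P(1,2) show ?thesis
    by (intro exI[of _ P] exI[of _ outs]) (auto simp: Ms_def algebra_simps)
qed

theorem mainTheorem2:
  shows "\<exists>C::real. \<forall>n\<ge>1. \<forall>m\<ge>1. \<exists>P outs.
    valid_program (m * n\<^sup>2 + n) P outs \<and>
    real (length P) \<le> C * (real m * (real n)\<^sup>2) \<and>
    (\<forall>(t::real) (G :: real \<Rightarrow> real vec \<Rightarrow> real vec) (x0 :: real vec) x U \<phi>.
       let dt = t / real m; E = euler_map \<phi> m; As = stored_matrices G m dt x in
       t > 0 \<and> differentiable_field n G \<and> x0 \<in> carrier_vec n \<and> x 0 = x0 \<and>
       implicit_euler n m dt G x U \<phi> \<and> differentially_invertible E x0 \<longrightarrow>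
         set As \<subseteq> carrier_mat n n \<and>
         real (length (matrix_data As)) \<le> C * (real m * (real n)\<^sup>2) \<and>
         (\<forall>v\<in>carrier_vec n.
            run_program P outs (matrix_data As @ list_of_vec v) =
              list_of_vec (the (mat_inverse (jacobian E x0)) *\<^sub>v v)))"
proof (intro exI[of _ "2::real"] allI impI)
  fix n m :: nat assume n: "1 \<le> n" and m: "1 \<le> m"
  obtain P outs where P: "valid_program (m * n\<^sup>2 + n) P outs" "length P \<le> 2 * (m * n\<^sup>2)"
    "\<And>As v. length As = m \<Longrightarrow> set As \<subseteq> carrier_mat n n \<Longrightarrow> v \<in> carrier_vec n \<Longrightarrow>
      run_program P outs (matrix_data As @ list_of_vec v) =
        list_of_vec (foldr (\<lambda>A w. A *\<^sub>v w) As v)"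
    using iterated_product_program[OF n, of m] by blast
  have "real (length P) \<le> real (2 * (m * n\<^sup>2))" using P(2) of_nat_mono by blast
  then have len: "real (length P) \<le> 2 * (real m * (real n)\<^sup>2)" by simp
  show "\<exists>P outs. valid_program (m * n\<^sup>2 + n) P outs \<and>
    real (length P) \<le> 2 * (real m * (real n)\<^sup>2) \<and>
    (\<forall>(t::real) (G :: real \<Rightarrow> real vec \<Rightarrow> real vec) (x0 :: real vec) x U \<phi>.
       let dt = t / real m; E = euler_map \<phi> m; As = stored_matrices G m dt x in
       t > 0 \<and> differentiable_field n G \<and> x0 \<in> carrier_vec n \<and> x 0 = x0 \<and>
       implicit_euler n m dt G x U \<phi> \<and> differentially_invertible E x0 \<longrightarrow>
         set As \<subseteq> carrier_mat n n \<and>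
         real (length (matrix_data As)) \<le> 2 * (real m * (real n)\<^sup>2) \<and>
         (\<forall>v\<in>carrier_vec n.
            run_program P outs (matrix_data As @ list_of_vec v) =
              list_of_vec (the (mat_inverse (jacobian E x0)) *\<^sub>v v)))"
    unfolding Let_def
  proof (intro exI[of _ P] exI[of _ outs] conjI allI impI P(1) len ballI; elim conjE)
    fix t G and x0 :: "real vec" and x :: "nat \<Rightarrow> real vec" and U \<phi>
    assume G: "differentiable_field n G" and x0: "x 0 = x0"
      and ie: "implicit_euler n m (t / real m) G x U \<phi>"
      and inv: "differentially_invertible (euler_map \<phi> m) x0"
    let ?As = "stored_matrices G m (t / real m) x"
    have As: "set ?As \<subseteq> carrier_mat n n" "length ?As = m"
      using euler_map_inverse_jacobian(1)[OF ie G] inv x0 by (auto simp: stored_matrices_def)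
    show "set ?As \<subseteq> carrier_mat n n" by fact
    show "real (length (matrix_data ?As)) \<le> 2 * (real m * (real n)\<^sup>2)"
      using length_matrix_data[OF As(1)] As(2) by simp
    fix v :: "real vec" assume v: "v \<in> carrier_vec n"
    show "run_program P outs (matrix_data ?As @ list_of_vec v) =
        list_of_vec (the (mat_inverse (jacobian (euler_map \<phi> m) x0)) *\<^sub>v v)"
      using P(3)[OF As(2,1) v] euler_map_inverse_jacobian(2)[OF ie G _ v] inv x0 by simp
  qed
qed

end
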